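(* Let $R$ be a ring, let $M$ be a pure extending right $R$-module and let $N$ be a direct summand of $M$. Then $N$ is a pure extending $R$-module.
   Context: Rings are associative with unity and modules are unital right modules. A submodule $P$ of a right $R$-module $M$ is pure in $M$ if for every left $R$-module $N$ the induced map $P\otimes_R N\to M\otimes_R N$ is injective. A submodule $N$ of $L$ is essential in $L$ if $N\cap X\neq 0$ for every nonzero submodule $X$ of $L$. An $R$-module $M$ is pure extending if every pure submodule of $M$ is essential in some direct summand of $M$. *)

theory Defs
  imports "HOL-Algebra.Module" "HOL-Algebra.AbelCoset" "HOL-Algebra.Generated_Groups"
    "HOL-Algebra.Free_Abelian_Groups"
begin

section \<open>One-sided modules over a ring\<close>

text \<open>
  The library locale \<open>module\<close> requires a commutative ring, so only its record type and its
  \<open>submodule\<close> locale (which makes no assumption on the ring) are reused here.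
  In a right module, \<open>a \<odot>\<^bsub>M\<^esub> x\<close> stands for the product of \<open>x\<close> by \<open>a\<close> from the right; the side
  is visible only in the associativity law. The fields \<open>mult\<close> and \<open>one\<close> that the record inherits
  from rings are never used.
\<close>

locale left_module = R?: ring R + M?: abelian_group M for R (structure) and M (structure) +
  assumes smult_closed [simp, intro]:
      "\<lbrakk>a \<in> carrier R; x \<in> carrier M\<rbrakk> \<Longrightarrow> a \<odot>\<^bsub>M\<^esub> x \<in> carrier M"
    and smult_l_distr:
      "\<lbrakk>a \<in> carrier R; b \<in> carrier R; x \<in> carrier M\<rbrakk> \<Longrightarrow>
      (a \<oplus>\<^bsub>R\<^esub> b) \<odot>\<^bsub>M\<^esub> x = a \<odot>\<^bsub>M\<^esub> x \<oplus>\<^bsub>M\<^esub> b \<odot>\<^bsub>M\<^esub> x"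
    and smult_r_distr:
      "\<lbrakk>a \<in> carrier R; x \<in> carrier M; y \<in> carrier M\<rbrakk> \<Longrightarrow>
      a \<odot>\<^bsub>M\<^esub> (x \<oplus>\<^bsub>M\<^esub> y) = a \<odot>\<^bsub>M\<^esub> x \<oplus>\<^bsub>M\<^esub> a \<odot>\<^bsub>M\<^esub> y"
    and smult_assoc:
      "\<lbrakk>a \<in> carrier R; b \<in> carrier R; x \<in> carrier M\<rbrakk> \<Longrightarrow>
      (a \<otimes>\<^bsub>R\<^esub> b) \<odot>\<^bsub>M\<^esub> x = a \<odot>\<^bsub>M\<^esub> (b \<odot>\<^bsub>M\<^esub> x)"
    and smult_one [simp]:
      "x \<in> carrier M \<Longrightarrow> \<one>\<^bsub>R\<^esub> \<odot>\<^bsub>M\<^esub> x = x"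

locale right_module = R?: ring R + M?: abelian_group M for R (structure) and M (structure) +
  assumes smult_closed [simp, intro]:
      "\<lbrakk>a \<in> carrier R; x \<in> carrier M\<rbrakk> \<Longrightarrow> a \<odot>\<^bsub>M\<^esub> x \<in> carrier M"
    and smult_l_distr:
      "\<lbrakk>a \<in> carrier R; b \<in> carrier R; x \<in> carrier M\<rbrakk> \<Longrightarrow>
      (a \<oplus>\<^bsub>R\<^esub> b) \<odot>\<^bsub>M\<^esub> x = a \<odot>\<^bsub>M\<^esub> x \<oplus>\<^bsub>M\<^esub> b \<odot>\<^bsub>M\<^esub> x"
    and smult_r_distr:
      "\<lbrakk>a \<in> carrier R; x \<in> carrier M; y \<in> carrier M\<rbrakk> \<Longrightarrow>
      a \<odot>\<^bsub>M\<^esub> (x \<oplus>\<^bsub>M\<^esub> y) = a \<odot>\<^bsub>M\<^esub> x \<oplus>\<^bsub>M\<^esub> a \<odot>\<^bsub>M\<^esub> y"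
    and smult_assoc:
      "\<lbrakk>a \<in> carrier R; b \<in> carrier R; x \<in> carrier M\<rbrakk> \<Longrightarrow>
      (a \<otimes>\<^bsub>R\<^esub> b) \<odot>\<^bsub>M\<^esub> x = b \<odot>\<^bsub>M\<^esub> (a \<odot>\<^bsub>M\<^esub> x)"
    and smult_one [simp]:
      "x \<in> carrier M \<Longrightarrow> \<one>\<^bsub>R\<^esub> \<odot>\<^bsub>M\<^esub> x = x"

section \<open>Tensor product of a right module and a left module\<close>

definition tensor_relators ::
  "('a, 'c) ring_scheme \<Rightarrow> ('a, 'm, 'd) module_scheme \<Rightarrow> ('a, 'n, 'e) module_scheme \<Rightarrow>
    ('m \<times> 'n \<Rightarrow>\<^sub>0 int) set" where
  "tensor_relators R M N =
     {frag_of (x \<oplus>\<^bsub>M\<^esub> x', y) - frag_of (x, y) - frag_of (x', y) | x x' y.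
        x \<in> carrier M \<and> x' \<in> carrier M \<and> y \<in> carrier N} \<union>
     {frag_of (x, y \<oplus>\<^bsub>N\<^esub> y') - frag_of (x, y) - frag_of (x, y') | x y y'.
        x \<in> carrier M \<and> y \<in> carrier N \<and> y' \<in> carrier N} \<union>
     {frag_of (a \<odot>\<^bsub>M\<^esub> x, y) - frag_of (x, a \<odot>\<^bsub>N\<^esub> y) | a x y.
        a \<in> carrier R \<and> x \<in> carrier M \<and> y \<in> carrier N}"

definition tensor_relations ::
  "('a, 'c) ring_scheme \<Rightarrow> ('a, 'm, 'd) module_scheme \<Rightarrow> ('a, 'n, 'e) module_scheme \<Rightarrow>
    ('m \<times> 'n \<Rightarrow>\<^sub>0 int) set" where
  "tensor_relations R M N =
     generate (free_Abelian_group (carrier M \<times> carrier N)) (tensor_relators R M N)"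

definition tensor_product ::
  "('a, 'c) ring_scheme \<Rightarrow> ('a, 'm, 'd) module_scheme \<Rightarrow> ('a, 'n, 'e) module_scheme \<Rightarrow>
    ('m \<times> 'n \<Rightarrow>\<^sub>0 int) set monoid" where
  "tensor_product R M N =
     free_Abelian_group (carrier M \<times> carrier N) Mod tensor_relations R M N"

text \<open>
  The map from \<open>P \<otimes> N\<close> to \<open>M \<otimes> N\<close> induced by \<open>f\<close> from \<open>P\<close> to \<open>M\<close>. The coset of a formal sum
  of pairs \<open>(p, y)\<close> is sent to the coset of the formal sum of the pairs \<open>(f p, y)\<close>; taking the
  set product with the target relations makes this independent of representatives.
\<close>

definition tensor_map ::
  "('a, 'c) ring_scheme \<Rightarrow> ('a, 'm, 'd) module_scheme \<Rightarrow> ('a, 'n, 'e) module_scheme \<Rightarrow>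
    ('p \<Rightarrow> 'm) \<Rightarrow> ('p \<times> 'n \<Rightarrow>\<^sub>0 int) set \<Rightarrow> ('m \<times> 'n \<Rightarrow>\<^sub>0 int) set" where
  "tensor_map R M N f X =
     tensor_relations R M N <#>\<^bsub>free_Abelian_group (carrier M \<times> carrier N)\<^esub>
       (frag_extend (\<lambda>(p, y). frag_of (f p, y)) ` X)"

definition tensor_inclusion_inj ::
  "('a, 'c) ring_scheme \<Rightarrow> ('a, 'm, 'd) module_scheme \<Rightarrow> 'm set \<Rightarrow>
    ('a, 'n, 'e) module_scheme \<Rightarrow> bool" where
  "tensor_inclusion_inj R M P N \<longleftrightarrow>
     inj_on (tensor_map R M N (\<lambda>p. p)) (carrier (tensor_product R (M\<lparr>carrier := P\<rparr>) N))"

section \<open>Pure submodules and pure extending modules\<close>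

text \<open>
  A formula cannot quantify over the types that carry the test modules \<open>N\<close>. The definition
  lets \<open>N\<close> range over all left modules carried by a set of lists over \<open>R\<close>; every finitely
  generated left module has a copy of this form. The theorem \<open>pure_submodule_imp_inj\<close>
  below shows that nothing is lost: the condition then holds for left modules over any type.
\<close>

definition pure_submodule ::
  "('a, 'c) ring_scheme \<Rightarrow> ('a, 'm, 'd) module_scheme \<Rightarrow> 'm set \<Rightarrow> bool" where
  "pure_submodule R M P \<longleftrightarrow>
     submodule P R M \<and>
     (\<forall>N :: ('a, 'a list) module. left_module R N \<longrightarrow> tensor_inclusion_inj R M P N)"

definition essential_submodule ::
  "('a, 'c) ring_scheme \<Rightarrow> ('a, 'm, 'd) module_scheme \<Rightarrow> 'm set \<Rightarrow> bool" where
  "essential_submodule R L N \<longleftrightarrow>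
     submodule N R L \<and>
     (\<forall>X. submodule X R L \<and> X \<noteq> {\<zero>\<^bsub>L\<^esub>} \<longrightarrow> N \<inter> X \<noteq> {\<zero>\<^bsub>L\<^esub>})"

definition direct_summand ::
  "('a, 'c) ring_scheme \<Rightarrow> ('a, 'm, 'd) module_scheme \<Rightarrow> 'm set \<Rightarrow> bool" where
  "direct_summand R M D \<longleftrightarrow>
     submodule D R M \<and>
     (\<exists>D'. submodule D' R M \<and> D <+>\<^bsub>M\<^esub> D' = carrier M \<and> D \<inter> D' = {\<zero>\<^bsub>M\<^esub>})"

definition pure_extending ::
  "('a, 'c) ring_scheme \<Rightarrow> ('a, 'm, 'd) module_scheme \<Rightarrow> bool" where
  "pure_extending R M \<longleftrightarrow>
     right_module R M \<and>
     (\<forall>P. pure_submodule R M P \<longrightarrow>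
       (\<exists>D. direct_summand R M D \<and> essential_submodule R (M\<lparr>carrier := D\<rparr>) P))"

section \<open>Purity does not depend on the type of the test modules\<close>

lemma right_module_submodule:
  assumes "right_module R M" "submodule P R M"
  shows "right_module R (M\<lparr>carrier := P\<rparr>)"
proof -
  interpret M: right_module R M by fact
  interpret P: submodule P R M by fact
  have mem: "x \<in> carrier M" if "x \<in> P" for x using P.mem_carrier[OF that] by simp
  have inv: "\<ominus>\<^bsub>M\<^esub> x \<in> P" if "x \<in> P" for x
    using P.m_inv_closed[OF that] by (simp add: a_inv_def)
  have add: "x \<oplus>\<^bsub>M\<^esub> y \<in> P" if "x \<in> P" "y \<in> P" for x y
    using P.m_closed[OF that] by simp
  have zero: "\<zero>\<^bsub>M\<^esub> \<in> P" using P.one_closed by simp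
  have "abelian_group (M\<lparr>carrier := P\<rparr>)"
  proof (rule abelian_groupI)
    fix x assume "x \<in> carrier (M\<lparr>carrier := P\<rparr>)"
    then show "\<exists>y\<in>carrier (M\<lparr>carrier := P\<rparr>). y \<oplus>\<^bsub>M\<lparr>carrier := P\<rparr>\<^esub> x = \<zero>\<^bsub>M\<lparr>carrier := P\<rparr>\<^esub>"
      using inv[of x] M.l_neg[OF mem[of x]] by auto
  qed (use mem add zero in \<open>auto simp: M.a_ac\<close>)
  then show ?thesis
    using mem by (auto intro!: right_module.intro right_module_axioms.intro M.R.ring_axioms
        simp: M.smult_l_distr M.smult_r_distr M.smult_assoc)
qed

lemma keys_diffD: "p \<in> Poly_Mapping.keys (a - b) \<Longrightarrow> p \<in> Poly_Mapping.keys a \<or> p \<in> Poly_Mapping.keys b"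
  for a b :: "'x \<Rightarrow>\<^sub>0 int"
  using keys_diff[of a b] by blast

lemma keys_diff_subset:
  "\<lbrakk>Poly_Mapping.keys a \<subseteq> S; Poly_Mapping.keys b \<subseteq> S\<rbrakk> \<Longrightarrow> Poly_Mapping.keys (a - b) \<subseteq> S"
  for a b :: "'x \<Rightarrow>\<^sub>0 int"
  using keys_diff[of a b] by blast

lemma tensor_relators_keys:
  assumes "right_module R M" "left_module R N" "r \<in> tensor_relators R M N"
  shows "Poly_Mapping.keys r \<subseteq> carrier M \<times> carrier N"
proof -
  interpret M: right_module R M by fact
  interpret N: left_module R N by fact
  show ?thesis
    using assms(3) unfolding tensor_relators_def by (auto dest!: keys_diffD)
qed

lemma tensor_relations_normal:
  assumes "right_module R M" "left_module R N"
  shows "tensor_relations R M N \<lhd> free_Abelian_group (carrier M \<times> carrier N)"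
proof -
  have "subgroup (tensor_relations R M N) (free_Abelian_group (carrier M \<times> carrier N))"
    unfolding tensor_relations_def
    by (rule group.generate_is_subgroup)
      (use tensor_relators_keys[OF assms] in auto)
  then show ?thesis
    by (simp add: comm_group.subgroup_imp_normal[OF abelian_free_Abelian_group])
qed

lemma tensor_relations_induct [consumes 3, case_names zero pos neg add]:
  assumes "right_module R M" "left_module R N" "z \<in> tensor_relations R M N"
    and "Q 0"
    and "\<And>r. r \<in> tensor_relators R M N \<Longrightarrow> Q r"
    and "\<And>r. r \<in> tensor_relators R M N \<Longrightarrow> Q (- r)"
    and "\<And>a b. \<lbrakk>Q a; Q b\<rbrakk> \<Longrightarrow> Q (a + b)"
  shows "Q z"
  using assms(3) unfolding tensor_relations_def
proof induction
  case (inv h)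
  then show ?case using assms(6)[OF inv] tensor_relators_keys[OF assms(1,2) inv] by simp
qed (use assms in auto)

lemma tensor_relations_0: "0 \<in> tensor_relations R M N"
  using generate.one[of "free_Abelian_group (carrier M \<times> carrier N)"]
  by (simp add: tensor_relations_def)

lemma tensor_relations_pos: "r \<in> tensor_relators R M N \<Longrightarrow> r \<in> tensor_relations R M N"
  by (simp add: tensor_relations_def generate.incl)

lemma tensor_relations_neg:
  assumes "r \<in> tensor_relators R M N" "Poly_Mapping.keys r \<subseteq> carrier M \<times> carrier N"
  shows "- r \<in> tensor_relations R M N"
  using generate.inv[OF assms(1), of "free_Abelian_group (carrier M \<times> carrier N)"] assms(2)
  by (simp add: tensor_relations_def)

lemma tensor_relations_add:
  "\<lbrakk>a \<in> tensor_relations R M N; b \<in> tensor_relations R M N\<rbrakk> \<Longrightarrow> a + b \<in> tensor_relations R M N"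
  using generate.eng[of a "free_Abelian_group (carrier M \<times> carrier N)" "tensor_relators R M N" b]
  by (simp add: tensor_relations_def)

lemma tensor_relations_functorial:
  assumes M: "right_module R M" and M': "right_module R M'"
    and N: "left_module R N" and N': "left_module R N'"
    and f: "\<And>x. x \<in> carrier M \<Longrightarrow> f x \<in> carrier M'"
      "\<And>x y. \<lbrakk>x \<in> carrier M; y \<in> carrier M\<rbrakk> \<Longrightarrow> f (x \<oplus>\<^bsub>M\<^esub> y) = f x \<oplus>\<^bsub>M'\<^esub> f y"
      "\<And>a x. \<lbrakk>a \<in> carrier R; x \<in> carrier M\<rbrakk> \<Longrightarrow> f (a \<odot>\<^bsub>M\<^esub> x) = a \<odot>\<^bsub>M'\<^esub> f x"
    and h: "\<And>x. x \<in> carrier N \<Longrightarrow> h x \<in> carrier N'"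
      "\<And>x y. \<lbrakk>x \<in> carrier N; y \<in> carrier N\<rbrakk> \<Longrightarrow> h (x \<oplus>\<^bsub>N\<^esub> y) = h x \<oplus>\<^bsub>N'\<^esub> h y"
      "\<And>a x. \<lbrakk>a \<in> carrier R; x \<in> carrier N\<rbrakk> \<Longrightarrow> h (a \<odot>\<^bsub>N\<^esub> x) = a \<odot>\<^bsub>N'\<^esub> h x"
    and z: "z \<in> tensor_relations R M N"
  shows "frag_extend (\<lambda>(x, y). frag_of (f x, h y)) z \<in> tensor_relations R M' N'"
proof -
  interpret M: right_module R M by fact
  interpret N: left_module R N by fact
  let ?g = "frag_extend (\<lambda>(x, y). frag_of (f x, h y))"
  have rel: "?g r \<in> tensor_relators R M' N'" if "r \<in> tensor_relators R M N" for r
  proof -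
    from that consider
      (1) x x' y where "r = frag_of (x \<oplus>\<^bsub>M\<^esub> x', y) - frag_of (x, y) - frag_of (x', y)"
        "x \<in> carrier M" "x' \<in> carrier M" "y \<in> carrier N"
    | (2) x y y' where "r = frag_of (x, y \<oplus>\<^bsub>N\<^esub> y') - frag_of (x, y) - frag_of (x, y')"
        "x \<in> carrier M" "y \<in> carrier N" "y' \<in> carrier N"
    | (3) a x y where "r = frag_of (a \<odot>\<^bsub>M\<^esub> x, y) - frag_of (x, a \<odot>\<^bsub>N\<^esub> y)"
        "a \<in> carrier R" "x \<in> carrier M" "y \<in> carrier N"
      unfolding tensor_relators_def by blast
    then show ?thesis
    proof cases
      case 1
      then have "?g r = frag_of (f x \<oplus>\<^bsub>M'\<^esub> f x', h y) - frag_of (f x, h y) - frag_of (f x', h y)"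
        by (simp add: frag_extend_diff f)
      then show ?thesis unfolding tensor_relators_def using 1 f(1) h(1) by blast
    next
      case 2
      then have "?g r = frag_of (f x, h y \<oplus>\<^bsub>N'\<^esub> h y') - frag_of (f x, h y) - frag_of (f x, h y')"
        by (simp add: frag_extend_diff h)
      then show ?thesis unfolding tensor_relators_def using 2 f(1) h(1) by blast
    next
      case 3
      then have "?g r = frag_of (a \<odot>\<^bsub>M'\<^esub> f x, h y) - frag_of (f x, a \<odot>\<^bsub>N'\<^esub> h y)"
        by (simp add: frag_extend_diff f h)
      then show ?thesis unfolding tensor_relators_def using 3 f(1) h(1) by blast
    qed
  qed
  from M N z show ?thesis
  proof (induction rule: tensor_relations_induct)
    case (neg r)
    then show ?case
      using rel tensor_relators_keys[OF M' N'] by (simp add: frag_extend_minus tensor_relations_neg)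
  qed (auto simp: tensor_relations_0 frag_extend_add intro: rel tensor_relations_pos tensor_relations_add)
qed

lemma tensor_map_coset:
  assumes M: "right_module R M" and M': "right_module R M'" and N: "left_module R N"
    and f: "\<And>x. x \<in> carrier M \<Longrightarrow> f x \<in> carrier M'"
      "\<And>x y. \<lbrakk>x \<in> carrier M; y \<in> carrier M\<rbrakk> \<Longrightarrow> f (x \<oplus>\<^bsub>M\<^esub> y) = f x \<oplus>\<^bsub>M'\<^esub> f y"
      "\<And>a x. \<lbrakk>a \<in> carrier R; x \<in> carrier M\<rbrakk> \<Longrightarrow> f (a \<odot>\<^bsub>M\<^esub> x) = a \<odot>\<^bsub>M'\<^esub> f x"
  shows "tensor_map R M' N f
      (tensor_relations R M N #>\<^bsub>free_Abelian_group (carrier M \<times> carrier N)\<^esub> z) =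
    tensor_relations R M' N #>\<^bsub>free_Abelian_group (carrier M' \<times> carrier N)\<^esub>
      frag_extend (\<lambda>(x, y). frag_of (f x, y)) z"
    (is "?l = ?r")
proof -
  let ?g = "frag_extend (\<lambda>(x, y). frag_of (f x, y))"
  have g: "?g t \<in> tensor_relations R M' N" if "t \<in> tensor_relations R M N" for t
    using tensor_relations_functorial[OF M M' N N f, of "\<lambda>y. y"] that by simp
  show ?thesis
  proof (intro equalityI subsetI)
    fix u assume "u \<in> ?l"
    then obtain s t where "s \<in> tensor_relations R M' N" "t \<in> tensor_relations R M N"
      "u = s + ?g (t + z)"
      by (auto simp: tensor_map_def set_mult_def r_coset_def)
    then have "u = (s + ?g t) + ?g z" "s + ?g t \<in> tensor_relations R M' N"
      by (auto simp: frag_extend_add g intro: tensor_relations_add)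
    then show "u \<in> ?r" by (auto simp: r_coset_def)
  next
    fix u assume "u \<in> ?r"
    then obtain s where s: "s \<in> tensor_relations R M' N" "u = s + ?g z"
      by (auto simp: r_coset_def)
    have "z \<in> tensor_relations R M N #>\<^bsub>free_Abelian_group (carrier M \<times> carrier N)\<^esub> z"
      using tensor_relations_0[of R M N] by (force simp: r_coset_def)
    with s show "u \<in> ?l"
      unfolding tensor_map_def set_mult_def by auto
  qed
qed

lemma tensor_map_hom:
  assumes M: "right_module R M" and M': "right_module R M'" and N: "left_module R N"
    and f: "\<And>x. x \<in> carrier M \<Longrightarrow> f x \<in> carrier M'"
      "\<And>x y. \<lbrakk>x \<in> carrier M; y \<in> carrier M\<rbrakk> \<Longrightarrow> f (x \<oplus>\<^bsub>M\<^esub> y) = f x \<oplus>\<^bsub>M'\<^esub> f y"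
      "\<And>a x. \<lbrakk>a \<in> carrier R; x \<in> carrier M\<rbrakk> \<Longrightarrow> f (a \<odot>\<^bsub>M\<^esub> x) = a \<odot>\<^bsub>M'\<^esub> f x"
  shows "tensor_map R M' N f \<in> hom (tensor_product R M N) (tensor_product R M' N)"
proof (rule homI)
  let ?F = "free_Abelian_group (carrier M \<times> carrier N)"
  let ?F' = "free_Abelian_group (carrier M' \<times> carrier N)"
  let ?T = "tensor_relations R M N" and ?T' = "tensor_relations R M' N"
  let ?g = "frag_extend (\<lambda>(x, y). frag_of (f x, y))"
  have c: "tensor_map R M' N f (?T #>\<^bsub>?F\<^esub> z) = ?T' #>\<^bsub>?F'\<^esub> ?g z" for z
    by (rule tensor_map_coset[OF M M' N f])
  interpret T: normal ?T ?F by (rule tensor_relations_normal[OF M N])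
  interpret T': normal ?T' ?F' by (rule tensor_relations_normal[OF M' N])
  have k: "?g a \<in> carrier ?F'" if "a \<in> carrier ?F" for a
    using that keys_frag_extend[of "\<lambda>(x, y). frag_of (f x, y)" a] f(1) by fastforce
  fix X assume "X \<in> carrier (tensor_product R M N)"
  then obtain a where a: "a \<in> carrier ?F" "X = ?T #>\<^bsub>?F\<^esub> a"
    by (auto simp: tensor_product_def FactGroup_def RCOSETS_def)
  show "tensor_map R M' N f X \<in> carrier (tensor_product R M' N)"
    using k[OF a(1)] unfolding a(2) c tensor_product_def FactGroup_def RCOSETS_def by auto
  fix Y assume "Y \<in> carrier (tensor_product R M N)"
  then obtain b where b: "b \<in> carrier ?F" "Y = ?T #>\<^bsub>?F\<^esub> b"
    by (auto simp: tensor_product_def FactGroup_def RCOSETS_def)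
  show "tensor_map R M' N f (X \<otimes>\<^bsub>tensor_product R M N\<^esub> Y) =
      tensor_map R M' N f X \<otimes>\<^bsub>tensor_product R M' N\<^esub> tensor_map R M' N f Y"
    using T.rcos_sum[OF a(1) b(1)] T'.rcos_sum[OF k[OF a(1)] k[OF b(1)]]
    by (simp add: tensor_product_def FactGroup_def a(2) b(2) c frag_extend_add)
qed

lemma tensor_inclusion_inj_iff:
  fixes R :: "('a, 'c) ring_scheme" and M :: "('a, 'm, 'd) module_scheme"
    and N :: "('a, 'n, 'e) module_scheme"
  assumes M: "right_module R M" and P: "submodule P R M" and N: "left_module R N"
  shows "tensor_inclusion_inj R M P N \<longleftrightarrow>
    (\<forall>z. Poly_Mapping.keys z \<subseteq> P \<times> carrier N \<longrightarrow> z \<in> tensor_relations R M N \<longrightarrow>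
      z \<in> tensor_relations R (M\<lparr>carrier := P\<rparr>) N)"
proof -
  let ?F = "free_Abelian_group (P \<times> carrier N)"
  let ?F' = "free_Abelian_group (carrier M \<times> carrier N)"
  let ?T = "tensor_relations R (M\<lparr>carrier := P\<rparr>) N" and ?T' = "tensor_relations R M N"
  have MP: "right_module R (M\<lparr>carrier := P\<rparr>)" by (rule right_module_submodule[OF M P])
  have sub: "P \<subseteq> carrier M" using subgroup.subset[OF submodule.axioms(1)[OF P]] by simp
  interpret T: normal ?T ?F using tensor_relations_normal[OF MP N] by simp
  interpret T': normal ?T' ?F' by (rule tensor_relations_normal[OF M N])
  have id: "frag_extend (\<lambda>(x, y). frag_of (x, y)) z = z" for z :: "'m \<times> 'n \<Rightarrow>\<^sub>0 int"
    by (rule trans[OF frag_extend_eq frag_expansion[symmetric]]) auto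
  have c: "tensor_map R M N (\<lambda>p. p) (?T #>\<^bsub>?F\<^esub> z) = ?T' #>\<^bsub>?F'\<^esub> z" for z
    using tensor_map_coset[OF MP M N, of "\<lambda>p. p" z] sub by (simp add: id subset_iff)
  have eq: "?T #>\<^bsub>?F\<^esub> a = ?T #>\<^bsub>?F\<^esub> b \<longleftrightarrow> a - b \<in> ?T" for a b
  proof
    assume "?T #>\<^bsub>?F\<^esub> a = ?T #>\<^bsub>?F\<^esub> b"
    moreover have "a \<in> ?T #>\<^bsub>?F\<^esub> a"
      using tensor_relations_0[of R "M\<lparr>carrier := P\<rparr>" N] by (force simp: r_coset_def)
    ultimately show "a - b \<in> ?T" by (auto simp: r_coset_def)
  next
    assume ab: "a - b \<in> ?T"
    then have ba: "b - a \<in> ?T"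
      using T.m_inv_closed[OF ab] T.mem_carrier[OF ab]
      by (metis carrier_free_Abelian_group_iff inv_free_Abelian_group minus_diff_eq)
    have "t + a \<in> ?T #>\<^bsub>?F\<^esub> b" "t + b \<in> ?T #>\<^bsub>?F\<^esub> a" if "t \<in> ?T" for t
      using tensor_relations_add[OF that ab] tensor_relations_add[OF that ba]
      by (force simp: r_coset_def algebra_simps)+
    then show "?T #>\<^bsub>?F\<^esub> a = ?T #>\<^bsub>?F\<^esub> b" by (auto simp: r_coset_def)
  qed
  have eq': "?T' #>\<^bsub>?F'\<^esub> a = ?T' #>\<^bsub>?F'\<^esub> b \<longleftrightarrow> a - b \<in> ?T'" for a b
  proof
    assume "?T' #>\<^bsub>?F'\<^esub> a = ?T' #>\<^bsub>?F'\<^esub> b"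
    moreover have "a \<in> ?T' #>\<^bsub>?F'\<^esub> a"
      using tensor_relations_0[of R M N] by (force simp: r_coset_def)
    ultimately show "a - b \<in> ?T'" by (auto simp: r_coset_def)
  next
    assume ab: "a - b \<in> ?T'"
    then have ba: "b - a \<in> ?T'"
      using T'.m_inv_closed[OF ab] T'.mem_carrier[OF ab]
      by (metis carrier_free_Abelian_group_iff inv_free_Abelian_group minus_diff_eq)
    have "t + a \<in> ?T' #>\<^bsub>?F'\<^esub> b" "t + b \<in> ?T' #>\<^bsub>?F'\<^esub> a" if "t \<in> ?T'" for t
      using tensor_relations_add[OF that ab] tensor_relations_add[OF that ba]
      by (force simp: r_coset_def algebra_simps)+
    then show "?T' #>\<^bsub>?F'\<^esub> a = ?T' #>\<^bsub>?F'\<^esub> b" by (auto simp: r_coset_def)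
  qed
  have "tensor_inclusion_inj R M P N \<longleftrightarrow>
    (\<forall>a\<in>carrier ?F. \<forall>b\<in>carrier ?F. a - b \<in> ?T' \<longrightarrow> a - b \<in> ?T)"
    by (auto simp: tensor_inclusion_inj_def inj_on_def tensor_product_def FactGroup_def
        RCOSETS_def c eq eq')
  also have "\<dots> \<longleftrightarrow> (\<forall>z\<in>carrier ?F. z \<in> ?T' \<longrightarrow> z \<in> ?T)"
  proof
    assume *: "\<forall>a\<in>carrier ?F. \<forall>b\<in>carrier ?F. a - b \<in> ?T' \<longrightarrow> a - b \<in> ?T"
    show "\<forall>z\<in>carrier ?F. z \<in> ?T' \<longrightarrow> z \<in> ?T"
      using *[rule_format, of _ 0] by simp
  next
    assume "\<forall>z\<in>carrier ?F. z \<in> ?T' \<longrightarrow> z \<in> ?T"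
    then show "\<forall>a\<in>carrier ?F. \<forall>b\<in>carrier ?F. a - b \<in> ?T' \<longrightarrow> a - b \<in> ?T"
      using keys_diff_subset[of _ "P \<times> carrier N"]
      by (metis carrier_free_Abelian_group_iff)
  qed
  finally show ?thesis by (simp add: Ball_def)
qed

lemma tensor_relations_finite_support:
  assumes M: "right_module R M" and N: "left_module R N" and z: "z \<in> tensor_relations R M N"
  shows "\<exists>Y. finite Y \<and> Y \<subseteq> carrier N \<and>
    (\<forall>K. Y \<subseteq> K \<longrightarrow> z \<in> tensor_relations R M (N\<lparr>carrier := K\<rparr>))"
proof -
  interpret M: right_module R M by fact
  interpret N: left_module R N by fact
  have rel: "\<exists>Y. finite Y \<and> Y \<subseteq> carrier N \<and>
    (\<forall>K. Y \<subseteq> K \<longrightarrow> r \<in> tensor_relators R M (N\<lparr>carrier := K\<rparr>) \<and>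
      Poly_Mapping.keys r \<subseteq> carrier M \<times> K)" if r: "r \<in> tensor_relators R M N" for r
  proof -
    from r consider
      (1) x x' y where "r = frag_of (x \<oplus>\<^bsub>M\<^esub> x', y) - frag_of (x, y) - frag_of (x', y)"
        "x \<in> carrier M" "x' \<in> carrier M" "y \<in> carrier N"
    | (2) x y y' where "r = frag_of (x, y \<oplus>\<^bsub>N\<^esub> y') - frag_of (x, y) - frag_of (x, y')"
        "x \<in> carrier M" "y \<in> carrier N" "y' \<in> carrier N"
    | (3) a x y where "r = frag_of (a \<odot>\<^bsub>M\<^esub> x, y) - frag_of (x, a \<odot>\<^bsub>N\<^esub> y)"
        "a \<in> carrier R" "x \<in> carrier M" "y \<in> carrier N"
      unfolding tensor_relators_def by blast
    then show ?thesis
    proof cases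
      case 1
      have "r \<in> tensor_relators R M (N\<lparr>carrier := K\<rparr>)" if "{y} \<subseteq> K" for K
        unfolding tensor_relators_def using 1 that by auto
      moreover have "Poly_Mapping.keys r \<subseteq> carrier M \<times> K" if "{y} \<subseteq> K" for K
        using 1 that by (auto dest!: keys_diffD)
      ultimately show ?thesis using 1 by (intro exI[of _ "{y}"]) auto
    next
      case 2
      have "r \<in> tensor_relators R M (N\<lparr>carrier := K\<rparr>)" if "{y, y', y \<oplus>\<^bsub>N\<^esub> y'} \<subseteq> K" for K
        unfolding tensor_relators_def using 2 that by auto
      moreover have "Poly_Mapping.keys r \<subseteq> carrier M \<times> K" if "{y, y', y \<oplus>\<^bsub>N\<^esub> y'} \<subseteq> K" for K
        using 2 that by (auto dest!: keys_diffD)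
      ultimately show ?thesis using 2 by (intro exI[of _ "{y, y', y \<oplus>\<^bsub>N\<^esub> y'}"]) auto
    next
      case 3
      have "r \<in> tensor_relators R M (N\<lparr>carrier := K\<rparr>)" if "{y, a \<odot>\<^bsub>N\<^esub> y} \<subseteq> K" for K
        unfolding tensor_relators_def using 3 that by auto
      moreover have "Poly_Mapping.keys r \<subseteq> carrier M \<times> K" if "{y, a \<odot>\<^bsub>N\<^esub> y} \<subseteq> K" for K
        using 3 that by (auto dest!: keys_diffD)
      ultimately show ?thesis using 3 by (intro exI[of _ "{y, a \<odot>\<^bsub>N\<^esub> y}"]) auto
    qed
  qed
  from M N z show ?thesis
  proof (induction rule: tensor_relations_induct)
    case zero
    then show ?case by (auto simp: tensor_relations_0)
  next
    case (pos r)
    then show ?case using rel[OF pos] by (meson tensor_relations_pos)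
  next
    case (neg r)
    from rel[OF neg] obtain Y where Y: "finite Y" "Y \<subseteq> carrier N"
      "\<And>K. Y \<subseteq> K \<Longrightarrow> r \<in> tensor_relators R M (N\<lparr>carrier := K\<rparr>) \<and>
        Poly_Mapping.keys r \<subseteq> carrier M \<times> K" by blast
    show ?case
      using Y by (intro exI[of _ Y] conjI allI impI tensor_relations_neg) simp_all
  next
    case (add a b)
    then obtain Y Z where "finite Y" "Y \<subseteq> carrier N" "finite Z" "Z \<subseteq> carrier N"
      "\<forall>K. Y \<subseteq> K \<longrightarrow> a \<in> tensor_relations R M (N\<lparr>carrier := K\<rparr>)"
      "\<forall>K. Z \<subseteq> K \<longrightarrow> b \<in> tensor_relations R M (N\<lparr>carrier := K\<rparr>)" by blast
    then show ?case by (intro exI[of _ "Y \<union> Z"]) (auto intro!: tensor_relations_add)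
  qed
qed

lemma (in left_module) smult_l_null: "x \<in> carrier M \<Longrightarrow> \<zero>\<^bsub>R\<^esub> \<odot>\<^bsub>M\<^esub> x = \<zero>\<^bsub>M\<^esub>"
  using smult_l_distr[of "\<zero>\<^bsub>R\<^esub>" "\<zero>\<^bsub>R\<^esub>" x] M.add.l_cancel_one[of "\<zero>\<^bsub>R\<^esub> \<odot>\<^bsub>M\<^esub> x" "\<zero>\<^bsub>R\<^esub> \<odot>\<^bsub>M\<^esub> x"]
  by simp

lemma (in left_module) smult_r_null: "a \<in> carrier R \<Longrightarrow> a \<odot>\<^bsub>M\<^esub> \<zero>\<^bsub>M\<^esub> = \<zero>\<^bsub>M\<^esub>"
  using smult_r_distr[of a "\<zero>\<^bsub>M\<^esub>" "\<zero>\<^bsub>M\<^esub>"] M.add.l_cancel_one[of "a \<odot>\<^bsub>M\<^esub> \<zero>\<^bsub>M\<^esub>" "a \<odot>\<^bsub>M\<^esub> \<zero>\<^bsub>M\<^esub>"]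
  by simp

lemma (in left_module) smult_minus_one: "x \<in> carrier M \<Longrightarrow> (\<ominus>\<^bsub>R\<^esub> \<one>\<^bsub>R\<^esub>) \<odot>\<^bsub>M\<^esub> x \<oplus>\<^bsub>M\<^esub> x = \<zero>\<^bsub>M\<^esub>"
  using smult_l_distr[of "\<ominus>\<^bsub>R\<^esub> \<one>\<^bsub>R\<^esub>" "\<one>\<^bsub>R\<^esub>" x] by (simp add: R.l_neg smult_l_null)

lemma (in left_module) finite_subset_coded_by_lists:
  assumes "finite Y" "Y \<subseteq> carrier M"
  obtains K :: "'c set" and code :: "'c \<Rightarrow> 'a list" where
    "Y \<subseteq> K" "K \<subseteq> carrier M" "\<zero>\<^bsub>M\<^esub> \<in> K" "inj_on code K"
    "\<And>x y. \<lbrakk>x \<in> K; y \<in> K\<rbrakk> \<Longrightarrow> x \<oplus>\<^bsub>M\<^esub> y \<in> K"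
    "\<And>a x. \<lbrakk>a \<in> carrier R; x \<in> K\<rbrakk> \<Longrightarrow> a \<odot>\<^bsub>M\<^esub> x \<in> K"
proof -
  obtain ys where ys: "set ys = Y" using assms(1) finite_list by blast
  define comb where
    "comb rs ys = foldr (\<lambda>(r, y) s. r \<odot>\<^bsub>M\<^esub> y \<oplus>\<^bsub>M\<^esub> s) (zip rs ys) \<zero>\<^bsub>M\<^esub>" for rs ys
  have nil: "comb [] [] = \<zero>\<^bsub>M\<^esub>" and
    cons: "comb (r # rs) (y # ys) = r \<odot>\<^bsub>M\<^esub> y \<oplus>\<^bsub>M\<^esub> comb rs ys" for r rs y ys
    by (simp_all add: comb_def)
  define K where "K = {comb rs ys | rs. length rs = length ys \<and> set rs \<subseteq> carrier R}"
  have closed: "comb rs ys \<in> carrier M"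
    if "length rs = length ys" "set rs \<subseteq> carrier R" "set ys \<subseteq> carrier M" for rs ys
    using that by (induction rs ys rule: list_induct2) (auto simp: nil cons)
  have add: "comb (map2 (\<oplus>\<^bsub>R\<^esub>) rs ss) ys = comb rs ys \<oplus>\<^bsub>M\<^esub> comb ss ys"
    if "length rs = length ss" "length ss = length ys" "set rs \<subseteq> carrier R" "set ss \<subseteq> carrier R"
      "set ys \<subseteq> carrier M" for rs ss ys
    using that
    by (induction rs ss ys rule: list_induct3)
      (auto simp: nil cons closed smult_l_distr M.a_ac)
  have scale: "comb (map ((\<otimes>\<^bsub>R\<^esub>) a) rs) ys = a \<odot>\<^bsub>M\<^esub> comb rs ys"
    if "length rs = length ys" "a \<in> carrier R" "set rs \<subseteq> carrier R" "set ys \<subseteq> carrier M" for a rs ys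
    using that
    by (induction rs ys rule: list_induct2)
      (auto simp: nil cons closed smult_r_null smult_r_distr smult_assoc)
  have null: "comb (replicate (length ys) \<zero>\<^bsub>R\<^esub>) ys = \<zero>\<^bsub>M\<^esub>" if "set ys \<subseteq> carrier M" for ys
    using that by (induction ys) (auto simp: nil cons smult_l_null)
  have gen: "\<exists>rs. length rs = length ys \<and> set rs \<subseteq> carrier R \<and> y = comb rs ys"
    if "y \<in> set ys" "set ys \<subseteq> carrier M" for y ys
    using that
  proof (induction ys)
    case (Cons x xs)
    show ?case
    proof (cases "y = x")
      case True
      show ?thesis
        by (rule exI[of _ "\<one>\<^bsub>R\<^esub> # replicate (length xs) \<zero>\<^bsub>R\<^esub>"])
          (use Cons.prems True null[of xs] in \<open>auto simp: cons\<close>)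
    next
      case False
      then obtain rs where rs: "length rs = length xs" "set rs \<subseteq> carrier R" "y = comb rs xs"
        using Cons by auto
      show ?thesis
        by (rule exI[of _ "\<zero>\<^bsub>R\<^esub> # rs"])
          (use Cons.prems rs closed[of rs xs] in \<open>auto simp: cons smult_l_null\<close>)
    qed
  qed simp
  have ysM: "set ys \<subseteq> carrier M" using ys assms(2) by simp
  have "\<forall>x\<in>K. \<exists>rs. x = comb rs ys" by (auto simp: K_def)
  then obtain code where code: "\<And>x. x \<in> K \<Longrightarrow> x = comb (code x) ys" by metis
  show thesis
  proof
    show "Y \<subseteq> K" using gen[OF _ ysM] ys by (auto simp: K_def)
    show "K \<subseteq> carrier M" using closed[OF _ _ ysM] by (auto simp: K_def)
    show "\<zero>\<^bsub>M\<^esub> \<in> K"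
      unfolding K_def using null[OF ysM]
      by (auto intro!: exI[of _ "replicate (length ys) \<zero>\<^bsub>R\<^esub>"])
    show "inj_on code K" by (rule inj_on_inverseI[of _ "\<lambda>rs. comb rs ys"]) (simp add: code[symmetric])
    fix x y assume "x \<in> K" "y \<in> K"
    then obtain rs ss where "length rs = length ys" "set rs \<subseteq> carrier R" "x = comb rs ys"
      "length ss = length ys" "set ss \<subseteq> carrier R" "y = comb ss ys" by (auto simp: K_def)
    then show "x \<oplus>\<^bsub>M\<^esub> y \<in> K"
      unfolding K_def using add[of rs ss ys] ysM
      by (intro CollectI exI[of _ "map2 (\<oplus>\<^bsub>R\<^esub>) rs ss"])
        (auto intro!: R.a_closed elim!: in_set_zipE)
  next
    fix a x assume "a \<in> carrier R" "x \<in> K"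
    then obtain rs where "length rs = length ys" "set rs \<subseteq> carrier R" "x = comb rs ys"
      by (auto simp: K_def)
    with \<open>a \<in> carrier R\<close> show "a \<odot>\<^bsub>M\<^esub> x \<in> K"
      unfolding K_def using scale[of rs ys a] ysM
      by (intro CollectI exI[of _ "map ((\<otimes>\<^bsub>R\<^esub>) a) rs"]) (auto intro!: R.m_closed)
  qed
qed

theorem pure_submodule_imp_inj:
  fixes R :: "('a, 'c) ring_scheme" and M :: "('a, 'm, 'd) module_scheme"
    and N :: "('a, 'n, 'e) module_scheme"
  assumes M: "right_module R M" and P: "pure_submodule R M P" and N: "left_module R N"
  shows "tensor_inclusion_inj R M P N"
proof -
  interpret N: left_module R N by fact
  let ?P = "M\<lparr>carrier := P\<rparr>"
  have sub: "submodule P R M" using P by (simp add: pure_submodule_def)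
  have MP: "right_module R ?P" by (rule right_module_submodule[OF M sub])
  have "z \<in> tensor_relations R ?P N"
    if keys: "Poly_Mapping.keys z \<subseteq> P \<times> carrier N" and z: "z \<in> tensor_relations R M N" for z
  proof -
    obtain Y where Y: "finite Y" "Y \<subseteq> carrier N"
      "\<And>K. Y \<subseteq> K \<Longrightarrow> z \<in> tensor_relations R M (N\<lparr>carrier := K\<rparr>)"
      using tensor_relations_finite_support[OF M N z] by blast
    have "finite (Y \<union> snd ` Poly_Mapping.keys z)" "Y \<union> snd ` Poly_Mapping.keys z \<subseteq> carrier N"
      using Y keys by auto
    from N.finite_subset_coded_by_lists[OF this]
    obtain K and code :: "'n \<Rightarrow> 'a list" where
      K: "Y \<union> snd ` Poly_Mapping.keys z \<subseteq> K" "K \<subseteq> carrier N" "\<zero>\<^bsub>N\<^esub> \<in> K" "inj_on code K"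
        "\<And>x y. \<lbrakk>x \<in> K; y \<in> K\<rbrakk> \<Longrightarrow> x \<oplus>\<^bsub>N\<^esub> y \<in> K"
        "\<And>a x. \<lbrakk>a \<in> carrier R; x \<in> K\<rbrakk> \<Longrightarrow> a \<odot>\<^bsub>N\<^esub> x \<in> K"
      by metis
    have KN: "x \<in> carrier N" if "x \<in> K" for x using K(2) that by blast
    have neg: "(\<ominus>\<^bsub>R\<^esub> \<one>\<^bsub>R\<^esub>) \<odot>\<^bsub>N\<^esub> x \<in> K" "(\<ominus>\<^bsub>R\<^esub> \<one>\<^bsub>R\<^esub>) \<odot>\<^bsub>N\<^esub> x \<oplus>\<^bsub>N\<^esub> x = \<zero>\<^bsub>N\<^esub>" if "x \<in> K" for x
      using K(6)[OF _ that] N.smult_minus_one[OF KN[OF that]] by auto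
    let ?K = "N\<lparr>carrier := K\<rparr>"
    have "abelian_group ?K"
    proof (rule abelian_groupI)
      fix x assume "x \<in> carrier ?K"
      then show "\<exists>y\<in>carrier ?K. y \<oplus>\<^bsub>?K\<^esub> x = \<zero>\<^bsub>?K\<^esub>" using neg[of x] by auto
    qed (use K(3,5) KN in \<open>auto simp: N.a_ac\<close>)
    then have K_mod: "left_module R ?K"
      using K(6) KN by (auto intro!: left_module.intro left_module_axioms.intro N.R.ring_axioms
          simp: N.smult_l_distr N.smult_r_distr N.smult_assoc)
    define dec where "dec = inv_into K code"
    have dec [simp]: "dec (code x) = x" if "x \<in> K" for x
      using K(4) that by (simp add: dec_def)
    define L :: "('a, 'a list) module" where
      "L = \<lparr>carrier = code ` K, mult = undefined, one = undefined, ring.zero = code \<zero>\<^bsub>N\<^esub>,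
        ring.add = (\<lambda>u v. code (dec u \<oplus>\<^bsub>N\<^esub> dec v)), smult = (\<lambda>a u. code (a \<odot>\<^bsub>N\<^esub> dec u))\<rparr>"
    have L: "carrier L = code ` K" "ring.zero L = code \<zero>\<^bsub>N\<^esub>"
      "ring.add L = (\<lambda>u v. code (dec u \<oplus>\<^bsub>N\<^esub> dec v))" "smult L = (\<lambda>a u. code (a \<odot>\<^bsub>N\<^esub> dec u))"
      by (simp_all add: L_def)
    have "abelian_group L"
    proof (rule abelian_groupI)
      fix x assume "x \<in> carrier L"
      then obtain k where k: "k \<in> K" "x = code k" by (auto simp: L)
      have "code ((\<ominus>\<^bsub>R\<^esub> \<one>\<^bsub>R\<^esub>) \<odot>\<^bsub>N\<^esub> k) \<oplus>\<^bsub>L\<^esub> x = \<zero>\<^bsub>L\<^esub>"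
        using neg[OF k(1)] k by (simp add: L)
      then show "\<exists>y\<in>carrier L. y \<oplus>\<^bsub>L\<^esub> x = \<zero>\<^bsub>L\<^esub>" using neg(1)[OF k(1)] by (auto simp: L)
    qed (use K(3,5) KN in \<open>auto simp: L N.a_ac\<close>)
    then have L_mod: "left_module R L"
      using K(5,6) KN by (auto intro!: left_module.intro left_module_axioms.intro N.R.ring_axioms
          simp: L N.smult_l_distr N.smult_r_distr N.smult_assoc)
    let ?c = "frag_extend (\<lambda>(x, y). frag_of (x, code y))"
    have "z \<in> tensor_relations R M ?K" using Y(3) K(1) by simp
    then have "?c z \<in> tensor_relations R M L"
      by (rule tensor_relations_functorial[OF M M K_mod L_mod, of "\<lambda>x. x" code, rotated 6])
        (auto simp: L K(5,6))
    moreover have "Poly_Mapping.keys (?c z) \<subseteq> P \<times> carrier L"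
      by (rule order_trans[OF keys_frag_extend]) (use keys K(1) in \<open>auto simp: L\<close>)
    moreover have "tensor_inclusion_inj R M P L"
      using P L_mod by (simp add: pure_submodule_def)
    ultimately have "?c z \<in> tensor_relations R ?P L"
      by (simp add: tensor_inclusion_inj_iff[OF M sub L_mod])
    then have "frag_extend (\<lambda>(x, y). frag_of (x, dec y)) (?c z) \<in> tensor_relations R ?P N"
      by (rule tensor_relations_functorial[OF MP MP L_mod N, of "\<lambda>x. x" dec, rotated 6])
        (auto simp: L K(5,6) KN)
    moreover have "frag_extend (\<lambda>(x, y). frag_of (x, dec y)) (?c z) = z"
    proof -
      have "Poly_Mapping.keys z \<subseteq> UNIV \<times> K" using K(1) by auto
      then show ?thesis
        by (induction z rule: frag_induction) (auto simp: frag_extend_diff)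
    qed
    ultimately show ?thesis by simp
  qed
  then show ?thesis by (simp add: tensor_inclusion_inj_iff[OF M sub N])
qed

end

theory Submission
  imports Defs
begin

text \<open>
  Let \<open>M = N \<oplus> N'\<close> and let \<open>P\<close> be pure in \<open>N\<close>. A summand of \<open>M\<close> that contains \<open>P\<close> as an essential
  submodule need not lie in \<open>N\<close>, so one enlarges \<open>P\<close> to \<open>P \<oplus> N'\<close>, which is pure in \<open>M\<close>, and takes
  a summand \<open>D\<close> of \<open>M\<close> in which it is essential. Since \<open>N' \<subseteq> D\<close>, the modular law gives
  \<open>D = (D \<inter> N) \<oplus> N'\<close>. Hence \<open>D \<inter> N\<close> is a summand of \<open>N\<close>, and \<open>P = (P \<oplus> N') \<inter> N\<close> is essential
  in it.
\<close>

section \<open>Submodules of a right module\<close>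

lemma (in right_module) smult_l_null: "x \<in> carrier M \<Longrightarrow> \<zero>\<^bsub>R\<^esub> \<odot>\<^bsub>M\<^esub> x = \<zero>\<^bsub>M\<^esub>"
  using smult_l_distr[of "\<zero>\<^bsub>R\<^esub>" "\<zero>\<^bsub>R\<^esub>" x] M.add.l_cancel_one[of "\<zero>\<^bsub>R\<^esub> \<odot>\<^bsub>M\<^esub> x" "\<zero>\<^bsub>R\<^esub> \<odot>\<^bsub>M\<^esub> x"]
  by simp

lemma (in right_module) smult_minus_one:
  assumes "x \<in> carrier M"
  shows "(\<ominus>\<^bsub>R\<^esub> \<one>\<^bsub>R\<^esub>) \<odot>\<^bsub>M\<^esub> x = \<ominus>\<^bsub>M\<^esub> x"
proof -
  have "(\<ominus>\<^bsub>R\<^esub> \<one>\<^bsub>R\<^esub>) \<odot>\<^bsub>M\<^esub> x \<oplus>\<^bsub>M\<^esub> x = \<zero>\<^bsub>M\<^esub>"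
    using smult_l_distr[of "\<ominus>\<^bsub>R\<^esub> \<one>\<^bsub>R\<^esub>" "\<one>\<^bsub>R\<^esub>" x] assms by (simp add: R.l_neg smult_l_null)
  then show ?thesis
    using assms by (intro M.minus_equality[symmetric]) auto
qed

text \<open>Negation is the action of minus one, so closure under scalars already gives closure
  under negation. This leaves only elementary closure conditions to check for sums and
  intersections.\<close>

lemma (in right_module) submodule_iff:
  "submodule P R M \<longleftrightarrow> P \<subseteq> carrier M \<and> \<zero>\<^bsub>M\<^esub> \<in> P \<and>
    (\<forall>x\<in>P. \<forall>y\<in>P. x \<oplus>\<^bsub>M\<^esub> y \<in> P) \<and> (\<forall>a\<in>carrier R. \<forall>x\<in>P. a \<odot>\<^bsub>M\<^esub> x \<in> P)"
proof
  assume "submodule P R M"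
  then interpret P: submodule P R M .
  show "P \<subseteq> carrier M \<and> \<zero>\<^bsub>M\<^esub> \<in> P \<and>
    (\<forall>x\<in>P. \<forall>y\<in>P. x \<oplus>\<^bsub>M\<^esub> y \<in> P) \<and> (\<forall>a\<in>carrier R. \<forall>x\<in>P. a \<odot>\<^bsub>M\<^esub> x \<in> P)"
    using P.subset P.one_closed P.m_closed P.smult_closed by auto
next
  assume P: "P \<subseteq> carrier M \<and> \<zero>\<^bsub>M\<^esub> \<in> P \<and>
    (\<forall>x\<in>P. \<forall>y\<in>P. x \<oplus>\<^bsub>M\<^esub> y \<in> P) \<and> (\<forall>a\<in>carrier R. \<forall>x\<in>P. a \<odot>\<^bsub>M\<^esub> x \<in> P)"
  have "\<ominus>\<^bsub>M\<^esub> x \<in> P" if "x \<in> P" for x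
    using P that smult_minus_one[of x] R.a_inv_closed[OF R.one_closed] by (metis subsetD)
  then have "subgroup P (add_monoid M)"
    using P by (intro subgroup.intro) (auto simp: a_inv_def)
  then show "submodule P R M"
    using P by (intro submodule.intro submodule_axioms.intro) auto
qed

lemma (in right_module) submodule_minus:
  assumes "submodule P R M" "x \<in> P" "y \<in> P"
  shows "x \<ominus>\<^bsub>M\<^esub> y \<in> P"
  using assms smult_minus_one[of y] unfolding submodule_iff a_minus_def
  by (metis R.a_inv_closed R.one_closed subsetD)

text \<open>Changing the carrier leaves zero, addition and the action alone, so the closure
  conditions are the same over \<open>N\<close> and over \<open>M\<close>. Every submodule of
  \<open>N\<close> can thus be handled inside \<open>M\<close>.\<close>

lemma submodule_of_submodule_iff:
  assumes "right_module R M" "submodule N R M"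
  shows "submodule P R (M\<lparr>carrier := N\<rparr>) \<longleftrightarrow> submodule P R M \<and> P \<subseteq> N"
  using assms(2)
  by (auto simp: right_module.submodule_iff[OF assms(1)]
      right_module.submodule_iff[OF right_module_submodule[OF assms]])

section \<open>Sums of submodules, direct sums and projections\<close>

lemma mem_set_add: "z \<in> A <+>\<^bsub>M\<^esub> B \<longleftrightarrow> (\<exists>a\<in>A. \<exists>b\<in>B. z = a \<oplus>\<^bsub>M\<^esub> b)"
  by (auto simp: set_add_defs)

lemma set_add_carrier_update: "A <+>\<^bsub>M\<lparr>carrier := N\<rparr>\<^esub> B = A <+>\<^bsub>M\<^esub> B"
  by (auto simp: mem_set_add)

lemma (in right_module) submodule_set_add:
  assumes A: "submodule A R M" and B: "submodule B R M"
  shows "submodule (A <+>\<^bsub>M\<^esub> B) R M"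
proof -
  have c: "A \<subseteq> carrier M" "B \<subseteq> carrier M" "\<zero>\<^bsub>M\<^esub> \<in> A" "\<zero>\<^bsub>M\<^esub> \<in> B"
    using A B by (auto simp: submodule_iff)
  have "(a \<oplus>\<^bsub>M\<^esub> b) \<oplus>\<^bsub>M\<^esub> (a' \<oplus>\<^bsub>M\<^esub> b') \<in> A <+>\<^bsub>M\<^esub> B"
    if "a \<in> A" "b \<in> B" "a' \<in> A" "b' \<in> B" for a b a' b'
  proof -
    have "(a \<oplus>\<^bsub>M\<^esub> b) \<oplus>\<^bsub>M\<^esub> (a' \<oplus>\<^bsub>M\<^esub> b') = (a \<oplus>\<^bsub>M\<^esub> a') \<oplus>\<^bsub>M\<^esub> (b \<oplus>\<^bsub>M\<^esub> b')"
      using that c by (simp add: subset_iff M.a_ac)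
    then show ?thesis using that A B unfolding mem_set_add submodule_iff by blast
  qed
  moreover have "r \<odot>\<^bsub>M\<^esub> (a \<oplus>\<^bsub>M\<^esub> b) \<in> A <+>\<^bsub>M\<^esub> B"
    if "r \<in> carrier R" "a \<in> A" "b \<in> B" for r a b
  proof -
    have "r \<odot>\<^bsub>M\<^esub> (a \<oplus>\<^bsub>M\<^esub> b) = r \<odot>\<^bsub>M\<^esub> a \<oplus>\<^bsub>M\<^esub> r \<odot>\<^bsub>M\<^esub> b"
      using that c by (intro smult_r_distr) auto
    then show ?thesis using that A B unfolding mem_set_add submodule_iff by blast
  qed
  moreover have "\<zero>\<^bsub>M\<^esub> \<in> A <+>\<^bsub>M\<^esub> B"
    using c unfolding mem_set_add by (metis M.l_zero M.zero_closed)
  moreover have "A <+>\<^bsub>M\<^esub> B \<subseteq> carrier M"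
    using c by (auto simp: mem_set_add subset_iff)
  ultimately show ?thesis
    by (auto simp: submodule_iff mem_set_add)
qed

lemma (in right_module) subset_set_add:
  assumes "submodule A R M" "submodule B R M"
  shows "A \<subseteq> A <+>\<^bsub>M\<^esub> B" "B \<subseteq> A <+>\<^bsub>M\<^esub> B"
proof -
  have c: "A \<subseteq> carrier M" "B \<subseteq> carrier M" "\<zero>\<^bsub>M\<^esub> \<in> A" "\<zero>\<^bsub>M\<^esub> \<in> B"
    using assms by (auto simp: submodule_iff)
  show "A \<subseteq> A <+>\<^bsub>M\<^esub> B"
    using c M.r_zero[symmetric] unfolding mem_set_add subset_iff by blast
  show "B \<subseteq> A <+>\<^bsub>M\<^esub> B"
    using c M.l_zero[symmetric] unfolding mem_set_add subset_iff by blast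
qed

text \<open>The element \<open>a - a' = b' - b\<close> lies in \<open>A\<close> by its first form
  and in \<open>B\<close> by its second, hence it is zero.\<close>

lemma (in right_module) direct_sum_unique:
  assumes A: "submodule A R M" and B: "submodule B R M" and AB: "A \<inter> B = {\<zero>\<^bsub>M\<^esub>}"
    and mem: "a \<in> A" "a' \<in> A" "b \<in> B" "b' \<in> B" and eq: "a \<oplus>\<^bsub>M\<^esub> b = a' \<oplus>\<^bsub>M\<^esub> b'"
  shows "a = a' \<and> b = b'"
proof -
  have c: "a \<in> carrier M" "a' \<in> carrier M" "b \<in> carrier M" "b' \<in> carrier M"
    using A B mem by (auto simp: submodule_iff)
  have "a \<ominus>\<^bsub>M\<^esub> a' = ((a \<oplus>\<^bsub>M\<^esub> b) \<ominus>\<^bsub>M\<^esub> b) \<ominus>\<^bsub>M\<^esub> a'"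
    using c by (simp add: a_minus_def M.a_assoc M.r_neg)
  also have "\<dots> = ((a' \<oplus>\<^bsub>M\<^esub> b') \<ominus>\<^bsub>M\<^esub> b) \<ominus>\<^bsub>M\<^esub> a'" by (simp only: eq)
  also have "\<dots> = (a' \<oplus>\<^bsub>M\<^esub> \<ominus>\<^bsub>M\<^esub> a') \<oplus>\<^bsub>M\<^esub> (b' \<ominus>\<^bsub>M\<^esub> b)"
    using c by (simp add: a_minus_def M.a_ac)
  also have "\<dots> = b' \<ominus>\<^bsub>M\<^esub> b"
    using c by (simp add: M.r_neg)
  finally have "a \<ominus>\<^bsub>M\<^esub> a' \<in> A \<inter> B"
    using submodule_minus[OF A mem(1,2)] submodule_minus[OF B mem(4,3)] by simp
  then have "a \<oplus>\<^bsub>M\<^esub> \<ominus>\<^bsub>M\<^esub> a' = a' \<oplus>\<^bsub>M\<^esub> \<ominus>\<^bsub>M\<^esub> a'"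
    using AB c by (simp add: a_minus_def M.r_neg)
  then have "a = a'" using c by simp
  then show ?thesis using eq c by simp
qed

text \<open>The functions are the two projections of \<open>A \<oplus> B\<close>. They are obtained
  by choosing components pointwise; uniqueness of components then makes the choice linear.\<close>

lemma (in right_module) direct_sum_projections:
  assumes A: "submodule A R M" and B: "submodule B R M"
    and sum: "A <+>\<^bsub>M\<^esub> B = carrier M" and AB: "A \<inter> B = {\<zero>\<^bsub>M\<^esub>}"
  obtains f g where
    "\<And>a b. \<lbrakk>a \<in> A; b \<in> B\<rbrakk> \<Longrightarrow> f (a \<oplus>\<^bsub>M\<^esub> b) = a"
    "\<And>a b. \<lbrakk>a \<in> A; b \<in> B\<rbrakk> \<Longrightarrow> g (a \<oplus>\<^bsub>M\<^esub> b) = b"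
    "\<And>x. x \<in> carrier M \<Longrightarrow> f x \<in> A"
    "\<And>x y. \<lbrakk>x \<in> carrier M; y \<in> carrier M\<rbrakk> \<Longrightarrow> f (x \<oplus>\<^bsub>M\<^esub> y) = f x \<oplus>\<^bsub>M\<^esub> f y"
    "\<And>r x. \<lbrakk>r \<in> carrier R; x \<in> carrier M\<rbrakk> \<Longrightarrow> f (r \<odot>\<^bsub>M\<^esub> x) = r \<odot>\<^bsub>M\<^esub> f x"
    "\<And>x. x \<in> carrier M \<Longrightarrow> g x \<in> B"
    "\<And>x y. \<lbrakk>x \<in> carrier M; y \<in> carrier M\<rbrakk> \<Longrightarrow> g (x \<oplus>\<^bsub>M\<^esub> y) = g x \<oplus>\<^bsub>M\<^esub> g y"
    "\<And>r x. \<lbrakk>r \<in> carrier R; x \<in> carrier M\<rbrakk> \<Longrightarrow> g (r \<odot>\<^bsub>M\<^esub> x) = r \<odot>\<^bsub>M\<^esub> g x"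
proof -
  have "\<forall>x\<in>carrier M. \<exists>a b. a \<in> A \<and> b \<in> B \<and> x = a \<oplus>\<^bsub>M\<^esub> b"
    using sum mem_set_add[of _ M A B] by blast
  then obtain f g where fg: "\<And>x. x \<in> carrier M \<Longrightarrow> f x \<in> A"
    "\<And>x. x \<in> carrier M \<Longrightarrow> g x \<in> B" "\<And>x. x \<in> carrier M \<Longrightarrow> x = f x \<oplus>\<^bsub>M\<^esub> g x"
    by metis
  have cA: "x \<in> carrier M" if "x \<in> A" for x using A that by (auto simp: submodule_iff)
  have cB: "x \<in> carrier M" if "x \<in> B" for x using B that by (auto simp: submodule_iff)
  have val: "f (a \<oplus>\<^bsub>M\<^esub> b) = a \<and> g (a \<oplus>\<^bsub>M\<^esub> b) = b" if "a \<in> A" "b \<in> B" for a b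
  proof -
    have c: "a \<oplus>\<^bsub>M\<^esub> b \<in> carrier M" using cA[OF that(1)] cB[OF that(2)] by simp
    show ?thesis
      using direct_sum_unique[OF A B AB fg(1)[OF c] that(1) fg(2)[OF c] that(2)] fg(3)[OF c]
      by simp
  qed
  have add: "f (x \<oplus>\<^bsub>M\<^esub> y) = f x \<oplus>\<^bsub>M\<^esub> f y \<and> g (x \<oplus>\<^bsub>M\<^esub> y) = g x \<oplus>\<^bsub>M\<^esub> g y"
    if xy: "x \<in> carrier M" "y \<in> carrier M" for x y
  proof -
    have "x \<oplus>\<^bsub>M\<^esub> y = (f x \<oplus>\<^bsub>M\<^esub> g x) \<oplus>\<^bsub>M\<^esub> (f y \<oplus>\<^bsub>M\<^esub> g y)" using xy fg(3) by simp
    also have "\<dots> = (f x \<oplus>\<^bsub>M\<^esub> f y) \<oplus>\<^bsub>M\<^esub> (g x \<oplus>\<^bsub>M\<^esub> g y)"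
      using cA[OF fg(1)] cB[OF fg(2)] xy by (simp add: M.a_ac)
    finally show ?thesis
      using val[of "f x \<oplus>\<^bsub>M\<^esub> f y" "g x \<oplus>\<^bsub>M\<^esub> g y"] A B fg(1,2) xy
      by (simp add: submodule_iff)
  qed
  have scale: "f (r \<odot>\<^bsub>M\<^esub> x) = r \<odot>\<^bsub>M\<^esub> f x \<and> g (r \<odot>\<^bsub>M\<^esub> x) = r \<odot>\<^bsub>M\<^esub> g x"
    if x: "r \<in> carrier R" "x \<in> carrier M" for r x
  proof -
    have "r \<odot>\<^bsub>M\<^esub> x = r \<odot>\<^bsub>M\<^esub> (f x \<oplus>\<^bsub>M\<^esub> g x)" using x fg(3) by simp
    also have "\<dots> = r \<odot>\<^bsub>M\<^esub> f x \<oplus>\<^bsub>M\<^esub> r \<odot>\<^bsub>M\<^esub> g x"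
      using cA[OF fg(1)] cB[OF fg(2)] x by (simp add: smult_r_distr)
    finally show ?thesis
      using val[of "r \<odot>\<^bsub>M\<^esub> f x" "r \<odot>\<^bsub>M\<^esub> g x"] A B fg(1,2) x
      by (simp add: submodule_iff)
  qed
  show thesis
    by (rule that[of f g]) (use val add scale fg(1,2) in simp_all)
qed

section \<open>Purity of a submodule enlarged by the complement\<close>

text \<open>After tensoring with \<open>L\<close>, an element of \<open>(P + B) \<otimes> L\<close>
  splits along the projections into a part from \<open>P \<otimes> L\<close> and a part from
  \<open>B \<otimes> L\<close>. If the element vanishes in \<open>M \<otimes> L\<close>, the first
  part vanishes in \<open>A \<otimes> L\<close>, hence in \<open>P \<otimes> L\<close> by purity,
  and the second vanishes in \<open>B \<otimes> L\<close>.\<close>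

lemma pure_submodule_set_add:
  assumes M: "right_module R M" and A: "submodule A R M" and B: "submodule B R M"
    and sum: "A <+>\<^bsub>M\<^esub> B = carrier M" and AB: "A \<inter> B = {\<zero>\<^bsub>M\<^esub>}"
    and P: "pure_submodule R (M\<lparr>carrier := A\<rparr>) P"
  shows "pure_submodule R M (P <+>\<^bsub>M\<^esub> B)"
proof -
  interpret M: right_module R M by fact
  let ?S = "P <+>\<^bsub>M\<^esub> B"
  have PA: "submodule P R (M\<lparr>carrier := A\<rparr>)" using P by (simp add: pure_submodule_def)
  then have PM: "submodule P R M" and "P \<subseteq> A"
    by (simp_all add: submodule_of_submodule_iff[OF M A])
  have S: "submodule ?S R M" by (rule M.submodule_set_add[OF PM B])
  note mods = right_module_submodule[OF M]
  note sub = M.subset_set_add[OF PM B]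
  have cS: "?S \<subseteq> carrier M" using S by (simp add: M.submodule_iff)
  obtain f g where fg:
    "\<And>a b. \<lbrakk>a \<in> A; b \<in> B\<rbrakk> \<Longrightarrow> f (a \<oplus>\<^bsub>M\<^esub> b) = a"
    "\<And>a b. \<lbrakk>a \<in> A; b \<in> B\<rbrakk> \<Longrightarrow> g (a \<oplus>\<^bsub>M\<^esub> b) = b"
    and f: "\<And>x. x \<in> carrier M \<Longrightarrow> f x \<in> A"
    "\<And>x y. \<lbrakk>x \<in> carrier M; y \<in> carrier M\<rbrakk> \<Longrightarrow> f (x \<oplus>\<^bsub>M\<^esub> y) = f x \<oplus>\<^bsub>M\<^esub> f y"
    "\<And>r x. \<lbrakk>r \<in> carrier R; x \<in> carrier M\<rbrakk> \<Longrightarrow> f (r \<odot>\<^bsub>M\<^esub> x) = r \<odot>\<^bsub>M\<^esub> f x"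
    and g: "\<And>x. x \<in> carrier M \<Longrightarrow> g x \<in> B"
    "\<And>x y. \<lbrakk>x \<in> carrier M; y \<in> carrier M\<rbrakk> \<Longrightarrow> g (x \<oplus>\<^bsub>M\<^esub> y) = g x \<oplus>\<^bsub>M\<^esub> g y"
    "\<And>r x. \<lbrakk>r \<in> carrier R; x \<in> carrier M\<rbrakk> \<Longrightarrow> g (r \<odot>\<^bsub>M\<^esub> x) = r \<odot>\<^bsub>M\<^esub> g x"
    by (rule M.direct_sum_projections[OF A B sum AB], rule that) assumption+
  \<comment> \<open>On \<open>?S\<close> the projection \<open>f\<close> lands in \<open>P\<close>
    and not merely in \<open>A\<close>: the \<open>A\<close>-component of \<open>p + b\<close> is
    \<open>p\<close>.\<close>
  have fgS: "f s \<in> P \<and> g s \<in> B \<and> s = f s \<oplus>\<^bsub>M\<^esub> g s" if "s \<in> ?S" for s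
    using that fg \<open>P \<subseteq> A\<close> by (auto simp: mem_set_add)
  \<comment> \<open>The purity of \<open>P\<close> in \<open>A\<close> is available for exactly the
    modules \<open>L\<close> that have to be tested here.\<close>
  have "tensor_inclusion_inj R M ?S L" if L: "left_module R L" for L :: "('a, 'a list) module"
    unfolding tensor_inclusion_inj_iff[OF M S L]
  proof (intro allI impI)
    fix z assume keys: "Poly_Mapping.keys z \<subseteq> ?S \<times> carrier L" and z: "z \<in> tensor_relations R M L"
    let ?T = "tensor_relations R (M\<lparr>carrier := ?S\<rparr>) L"
    let ?f = "frag_extend (\<lambda>(x, y). frag_of (f x, y))"
    let ?g = "frag_extend (\<lambda>(x, y). frag_of (g x, y))"
    \<comment> \<open>Functoriality along the inclusion of \<open>Q\<close> in \<open>?S\<close>; on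
      formal sums this inclusion acts as the identity.\<close>
    have incl: "w \<in> ?T" if "submodule Q R M" "Q \<subseteq> ?S" "w \<in> tensor_relations R (M\<lparr>carrier := Q\<rparr>) L"
      for Q w
    proof -
      have "frag_extend (\<lambda>(x, y). frag_of (x, y)) w \<in> ?T"
        by (rule tensor_relations_functorial[OF mods[OF that(1)] mods[OF S] L L,
              of "\<lambda>x. x" "\<lambda>y. y"]) (use that in auto)
      moreover have "frag_extend (\<lambda>(x, y). frag_of (x, y)) w = w"
        by (rule trans[OF frag_extend_eq frag_expansion[symmetric]]) auto
      ultimately show ?thesis by simp
    qed
    \<comment> \<open>The relators that make up \<open>z\<close> may involve elements of
      \<open>M\<close> outside \<open>?S\<close>, so applying \<open>f\<close> only yields a
      relation over \<open>A\<close>. The keys of \<open>?f z\<close>, however, have first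
      components in \<open>P\<close>, and purity turns this into a relation over
      \<open>P\<close>.\<close>
    have "?f z \<in> tensor_relations R (M\<lparr>carrier := A\<rparr>) L"
      by (rule tensor_relations_functorial[OF M mods[OF A] L L _ _ _ _ _ _ z, of f "\<lambda>y. y"])
        (use f in auto)
    moreover have "Poly_Mapping.keys (?f z) \<subseteq> P \<times> carrier L"
      by (rule order_trans[OF keys_frag_extend]) (use keys fgS in auto)
    moreover have "tensor_inclusion_inj R (M\<lparr>carrier := A\<rparr>) P L"
      using P L by (simp add: pure_submodule_def)
    ultimately have "?f z \<in> tensor_relations R (M\<lparr>carrier := P\<rparr>) L"
      by (simp add: tensor_inclusion_inj_iff[OF mods[OF A] PA L])
    then have fz: "?f z \<in> ?T" by (rule incl[OF PM sub(1)])
    \<comment> \<open>Since \<open>g\<close> maps all of \<open>M\<close> into \<open>B\<close>,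
      functoriality alone gives a relation over \<open>B\<close>.\<close>
    have "?g z \<in> tensor_relations R (M\<lparr>carrier := B\<rparr>) L"
      by (rule tensor_relations_functorial[OF M mods[OF B] L L _ _ _ _ _ _ z, of g "\<lambda>y. y"])
        (use g in auto)
    then have gz: "?g z \<in> ?T" by (rule incl[OF B sub(2)])
    \<comment> \<open>The induction on formal sums below builds them by differences, so
      \<open>?T\<close> has to be closed under negation.\<close>
    have T_minus: "- w \<in> ?T" if "w \<in> ?T" for w
    proof -
      interpret T: normal ?T "free_Abelian_group (?S \<times> carrier L)"
        using tensor_relations_normal[OF mods[OF S] L] by simp
      show ?thesis
        using T.m_inv_closed[OF that] T.mem_carrier[OF that]
        by (simp add: inv_free_Abelian_group)
    qed
    \<comment> \<open>For a single pair \<open>(s, y)\<close> this is the relator for additivity in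
      the first argument, applied to \<open>s = f s + g s\<close>. The general case follows by
      linearity.\<close>
    have "z - ?f z - ?g z \<in> ?T"
      using keys
    proof (induction z rule: frag_induction)
      case zero
      then show ?case by (simp add: tensor_relations_0)
    next
      case (one p)
      obtain s y where p: "p = (s, y)" "s \<in> ?S" "y \<in> carrier L"
        using one by (cases p) auto
      \<comment> \<open>Both components must lie in \<open>?S\<close>, so that the relator is one
        over \<open>?S\<close> and not just over \<open>M\<close>.\<close>
      have "f s \<in> ?S" "g s \<in> ?S" using fgS[OF p(2)] sub by auto
      then have "frag_of (f s \<oplus>\<^bsub>M\<^esub> g s, y) - frag_of (f s, y) - frag_of (g s, y)
          \<in> tensor_relators R (M\<lparr>carrier := ?S\<rparr>) L"
        unfolding tensor_relators_def using p(3) by simp blast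
      then show ?case
        using fgS[OF p(2)] by (auto simp: p(1) intro: tensor_relations_pos)
    next
      case (diff a b)
      have "a - b - ?f (a - b) - ?g (a - b) = (a - ?f a - ?g a) + - (b - ?f b - ?g b)"
        by (simp add: frag_extend_diff)
      then show ?case
        using tensor_relations_add[OF diff(1) T_minus[OF diff(2)]] by (simp only:)
    qed
    then have "z - ?f z - ?g z + ?f z + ?g z \<in> ?T"
      by (intro tensor_relations_add fz gz)
    then show "z \<in> ?T" by simp
  qed
  with S show ?thesis by (simp add: pure_submodule_def)
qed

section \<open>Summands and essential submodules cut down to a summand\<close>

text \<open>From \<open>B \<subseteq> D\<close> one gets \<open>D = (D \<inter> A) + B\<close>, so
  \<open>M = (D \<inter> A) + (B + D')\<close>. As \<open>D \<inter> A\<close> lies in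
  \<open>A\<close>, intersecting with \<open>A\<close> and the modular law give the complement
  \<open>A \<inter> (B + D')\<close> of \<open>D \<inter> A\<close> in \<open>A\<close>.\<close>

lemma direct_summand_Int:
  assumes M: "right_module R M" and A: "submodule A R M" and B: "submodule B R M"
    and sum: "A <+>\<^bsub>M\<^esub> B = carrier M" and AB: "A \<inter> B = {\<zero>\<^bsub>M\<^esub>}"
    and D: "direct_summand R M D" and BD: "B \<subseteq> D"
  shows "direct_summand R (M\<lparr>carrier := A\<rparr>) (D \<inter> A)"
proof -
  interpret M: right_module R M by fact
  obtain D' where Ds: "submodule D R M" and D': "submodule D' R M"
    and DD: "D <+>\<^bsub>M\<^esub> D' = carrier M" "D \<inter> D' = {\<zero>\<^bsub>M\<^esub>}"
    using D by (auto simp: direct_summand_def)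
  have c: "A \<subseteq> carrier M" "B \<subseteq> carrier M" "D \<subseteq> carrier M" "D' \<subseteq> carrier M"
    using A B Ds D' by (simp_all add: M.submodule_iff)
  have S: "submodule (B <+>\<^bsub>M\<^esub> D') R M" by (rule M.submodule_set_add[OF B D'])
  have sub1: "submodule (D \<inter> A) R M" using Ds A by (auto simp: M.submodule_iff)
  have sub2: "submodule (A \<inter> (B <+>\<^bsub>M\<^esub> D')) R M" using S A by (auto simp: M.submodule_iff)
  have zero: "\<zero>\<^bsub>M\<^esub> \<in> A" "\<zero>\<^bsub>M\<^esub> \<in> B" "\<zero>\<^bsub>M\<^esub> \<in> D" "\<zero>\<^bsub>M\<^esub> \<in> B <+>\<^bsub>M\<^esub> D'"
    using A B Ds S by (simp_all add: M.submodule_iff)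
  have "(D \<inter> A) <+>\<^bsub>M\<^esub> (A \<inter> (B <+>\<^bsub>M\<^esub> D')) = A"
  proof (intro equalityI subsetI)
    fix x assume "x \<in> (D \<inter> A) <+>\<^bsub>M\<^esub> (A \<inter> (B <+>\<^bsub>M\<^esub> D'))"
    then show "x \<in> A" using A by (auto simp: mem_set_add M.submodule_iff)
  next
    fix x assume x: "x \<in> A"
    then obtain d d' where d: "d \<in> D" "d' \<in> D'" "x = d \<oplus>\<^bsub>M\<^esub> d'"
      using c DD(1) mem_set_add[of x M D D'] by auto
    then obtain a b where a: "a \<in> A" "b \<in> B" "d = a \<oplus>\<^bsub>M\<^esub> b"
      using c sum mem_set_add[of d M A B] by auto
    have cc: "a \<in> carrier M" "b \<in> carrier M" "d \<in> carrier M" "d' \<in> carrier M" "x \<in> carrier M"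
      using a d c x by auto
    have "a = d \<ominus>\<^bsub>M\<^esub> b" using cc a(3) by (simp add: a_minus_def M.a_assoc M.r_neg)
    \<comment> \<open>Here \<open>B \<subseteq> D\<close> enters: both \<open>d\<close> and
      \<open>b\<close> lie in \<open>D\<close>.\<close>
    then have "a \<in> D" using M.submodule_minus[OF Ds d(1)] a(2) BD by auto
    have eq: "x = a \<oplus>\<^bsub>M\<^esub> (b \<oplus>\<^bsub>M\<^esub> d')" using cc a(3) d(3) by (simp add: M.a_assoc)
    have "a \<oplus>\<^bsub>M\<^esub> (b \<oplus>\<^bsub>M\<^esub> d') \<ominus>\<^bsub>M\<^esub> a = b \<oplus>\<^bsub>M\<^esub> d'"
      using cc by (simp add: a_minus_def M.a_comm[of a] M.a_assoc M.r_neg)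
    then have "b \<oplus>\<^bsub>M\<^esub> d' = x \<ominus>\<^bsub>M\<^esub> a" by (simp only: eq)
    then have "b \<oplus>\<^bsub>M\<^esub> d' \<in> A" using M.submodule_minus[OF A x a(1)] by simp
    then show "x \<in> (D \<inter> A) <+>\<^bsub>M\<^esub> (A \<inter> (B <+>\<^bsub>M\<^esub> D'))"
      using \<open>a \<in> D\<close> a(1,2) d(2) eq mem_set_add[of x M "D \<inter> A"]
        mem_set_add[of "b \<oplus>\<^bsub>M\<^esub> d'" M B D'] by blast
  qed
  moreover have "(D \<inter> A) \<inter> (A \<inter> (B <+>\<^bsub>M\<^esub> D')) = {\<zero>\<^bsub>M\<^esub>}"
  proof -
    have "x = \<zero>\<^bsub>M\<^esub>" if x: "x \<in> D" "x \<in> A" "x \<in> B <+>\<^bsub>M\<^esub> D'" for x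
    proof -
      obtain b d' where b: "b \<in> B" "d' \<in> D'" "x = b \<oplus>\<^bsub>M\<^esub> d'"
        using x(3) by (auto simp: mem_set_add)
      \<comment> \<open>Two decompositions of \<open>x\<close> along \<open>D\<close> and
        \<open>D'\<close> are compared, with \<open>b\<close> in \<open>D\<close> because
        \<open>B \<subseteq> D\<close>. They force \<open>x = b\<close>, which lies in
        \<open>A \<inter> B\<close>.\<close>
      have "x \<oplus>\<^bsub>M\<^esub> \<zero>\<^bsub>M\<^esub> = b \<oplus>\<^bsub>M\<^esub> d'" using b c x by auto
      moreover have "\<zero>\<^bsub>M\<^esub> \<in> D'" using D' by (simp add: M.submodule_iff)
      ultimately have "x = b"
        using M.direct_sum_unique[OF Ds D' DD(2) x(1) _ _ b(2)] b(1) BD by blast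
      then show ?thesis using AB x(2) b(1) by blast
    qed
    then show ?thesis using zero by blast
  qed
  ultimately show ?thesis
    unfolding direct_summand_def
    using sub1 sub2
    by (intro conjI exI[of _ "A \<inter> (B <+>\<^bsub>M\<^esub> D')"])
      (simp_all add: submodule_of_submodule_iff[OF M A] set_add_carrier_update)
qed

text \<open>A nonzero submodule \<open>X\<close> of \<open>D \<inter> A\<close> is also one of
  \<open>D\<close>, so it meets \<open>P + B\<close> nontrivially. Since \<open>X\<close> lies in
  \<open>A\<close> and \<open>(P + B) \<inter> A = P\<close>, that intersection is
  \<open>P \<inter> X\<close>.\<close>

lemma essential_submodule_Int:
  assumes M: "right_module R M" and A: "submodule A R M" and B: "submodule B R M"
    and AB: "A \<inter> B = {\<zero>\<^bsub>M\<^esub>}" and P: "submodule P R M" "P \<subseteq> A" and D: "submodule D R M"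
    and ess: "essential_submodule R (M\<lparr>carrier := D\<rparr>) (P <+>\<^bsub>M\<^esub> B)"
  shows "essential_submodule R (M\<lparr>carrier := D \<inter> A\<rparr>) P"
proof -
  interpret M: right_module R M by fact
  have DA: "submodule (D \<inter> A) R M" using D A by (auto simp: M.submodule_iff)
  have SD: "P <+>\<^bsub>M\<^esub> B \<subseteq> D"
    using ess by (simp add: essential_submodule_def submodule_of_submodule_iff[OF M D])
  have "P \<subseteq> D" using M.subset_set_add(1)[OF P(1) B] SD by blast
  have inter: "(P <+>\<^bsub>M\<^esub> B) \<inter> A \<subseteq> P"
  proof
    fix x assume "x \<in> (P <+>\<^bsub>M\<^esub> B) \<inter> A"
    then obtain p b where x: "x \<in> A" "p \<in> P" "b \<in> B" "x = p \<oplus>\<^bsub>M\<^esub> b"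
      by (auto simp: mem_set_add)
    have "x \<in> carrier M" "\<zero>\<^bsub>M\<^esub> \<in> B" using x A B by (auto simp: M.submodule_iff)
    \<comment> \<open>The decompositions \<open>x + 0\<close> and \<open>p + b\<close> along
      \<open>A\<close> and \<open>B\<close> agree.\<close>
    then have "x = p"
      using M.direct_sum_unique[OF A B AB x(1) _ _ x(3), of p "\<zero>\<^bsub>M\<^esub>"] x P(2) by auto
    then show "x \<in> P" using x by simp
  qed
  have "P \<inter> X \<noteq> {\<zero>\<^bsub>M\<^esub>}" if X: "submodule X R M" "X \<subseteq> D \<inter> A" "X \<noteq> {\<zero>\<^bsub>M\<^esub>}" for X
  proof -
    have "(P <+>\<^bsub>M\<^esub> B) \<inter> X \<noteq> {\<zero>\<^bsub>M\<^esub>}"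
      using ess X by (simp add: essential_submodule_def submodule_of_submodule_iff[OF M D])
    moreover have "(P <+>\<^bsub>M\<^esub> B) \<inter> X = P \<inter> X"
      using inter X(2) M.subset_set_add(1)[OF P(1) B] by blast
    ultimately show ?thesis by simp
  qed
  then show ?thesis
    using P \<open>P \<subseteq> D\<close>
    by (auto simp: essential_submodule_def submodule_of_submodule_iff[OF M DA])
qed

section \<open>Direct summands of pure extending modules\<close>

theorem proposition6:
  fixes R :: "('a, 'c) ring_scheme" and M :: "('a, 'm, 'd) module_scheme" and N :: "'m set"
  assumes "ring R"
    and "right_module R M"
    and "pure_extending R M"
    and "direct_summand R M N"
  shows "pure_extending R (M\<lparr>carrier := N\<rparr>)"
proof -
  note M = assms(2)
  interpret M: right_module R M by fact
  obtain N' where N: "submodule N R M" and N': "submodule N' R M"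
    and sum: "N <+>\<^bsub>M\<^esub> N' = carrier M" and int: "N \<inter> N' = {\<zero>\<^bsub>M\<^esub>}"
    using assms(4) by (auto simp: direct_summand_def)
  \<comment> \<open>Restricting the carrier to \<open>N\<close> and then to \<open>D\<close> is the
    same as restricting it to \<open>D\<close> at once, so the essentiality condition can be stated
    over \<open>M\<close>.\<close>
  have "\<exists>D. direct_summand R (M\<lparr>carrier := N\<rparr>) D \<and>
      essential_submodule R (M\<lparr>carrier := D\<rparr>) P"
    if P: "pure_submodule R (M\<lparr>carrier := N\<rparr>) P" for P
  proof -
    have PM: "submodule P R M" "P \<subseteq> N"
      using P by (simp_all add: pure_submodule_def submodule_of_submodule_iff[OF M N])
    have "pure_submodule R M (P <+>\<^bsub>M\<^esub> N')"
      by (rule pure_submodule_set_add[OF M N N' sum int P])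
    then obtain D where D: "direct_summand R M D"
      "essential_submodule R (M\<lparr>carrier := D\<rparr>) (P <+>\<^bsub>M\<^esub> N')"
      using assms(3) by (auto simp: pure_extending_def)
    have Ds: "submodule D R M" using D(1) by (simp add: direct_summand_def)
    have "P <+>\<^bsub>M\<^esub> N' \<subseteq> D"
      using D(2) by (simp add: essential_submodule_def submodule_of_submodule_iff[OF M Ds])
    then have "N' \<subseteq> D" using M.subset_set_add(2)[OF PM(1) N'] by blast
    \<comment> \<open>The witness is \<open>D \<inter> N\<close>, where \<open>D\<close> is the
      summand of \<open>M\<close> found for \<open>P + N'\<close>.\<close>
    then show ?thesis
      using direct_summand_Int[OF M N N' sum int D(1)]
        essential_submodule_Int[OF M N N' int PM Ds D(2)] by blast
  qed
  then show ?thesis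
    by (simp add: pure_extending_def right_module_submodule[OF M N])
qed

end
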